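(* There is no winning team consisting of exactly $4$ polyominoes. Moreover, the five sets $\mathcal{N}_{4,1}=\{L_2\}$, $\mathcal{N}_{4,2}=\{S_3,Z_2\}$, $\mathcal{N}_{4,3}=\{S_3,C_2\}$, $\mathcal{N}_{4,4}=\{S_4,L_3,C_2,Z_2\}$ and $\mathcal{N}_{4,5}=\{S_4,T_2,C_2,Z_2\}$ form a characterizing collection of losers for size $4$ teams; that is, each $\mathcal{N}_{4,i}$ is a losing team, and for every team $\mathcal{F}$ with exactly $4$ elements there is an $i\in\{1,\dots,5\}$ such that $\mathcal{N}_{4,i}\preceq\mathcal{F}$.
   Context: Board and polyominoes. The cells are the translates of the unit square $[0,1]\times[0,1]$ by vectors of $\mathbf{Z}^2$; identify a cell with the vector in $\mathbf{Z}^2$. Two cells are adjacent if they share an edge. A polyomino is a nonempty (finite or infinite) set of cells that is connected through adjacent cells, considered up to congruence (translations, rotations, reflections of the board). Game. Two players, maker (moving first) and breaker, alternately mark previously unmarked cells of the infinite board: in each turn the maker marks 1 cell and the breaker marks 2 cells. For a set $\mathcal{S}$ of finite polyominoes, the maker wins if after finitely many moves he has marked all the cells of a set congruent to some element of $\mathcal{S}$; the breaker wins if she prevents this. $\mathcal{S}$ is a winner (winning) if the maker has a winning strategy. Ancestors. $P\sqsubseteq Q$ ($P$ is an ancestor of $Q$) means that some congruent copy of $P$ is a subset of $Q$. A team is a set of polyominoes no element of which is an ancestor of another element; its size is its number of elements. Unbounded sets. A set of polyominoes is unbounded if it contains an infinite polyomino. If $\mathcal{T}$ is unbounded and $F_T$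 is a finite ancestor of $T$ for each $T\in\mathcal{T}$, then $\{F_T\mid T\in\mathcal{T}\}$ is a bounded restriction of $\mathcal{T}$. An unbounded set is a winner if each of its bounded restrictions is a winner. A set that is not a winner is a loser (losing). Simpler. $\mathcal{S}\preceq\mathcal{T}$ means that for all $Q\in\mathcal{T}$ there is $P\in\mathcal{S}$ with $P\sqsubseteq Q$. Particular polyominoes (up to congruence): $S_n=\{(0,0),\dots,(n-1,0)\}$; $L_n=S_n\cup\{(0,1)\}$; $T_2=\{(0,0),(1,0),(2,0),(1,1)\}$; $C_2=\{(0,0),(1,0),(0,1),(1,1)\}$; $Z_2=\{(0,0),(1,0),(0,1),(1,-1)\}$. *)

theory Defs
  imports Main
begin

text \<open>A cell is identified with the integer vector by which the unit square is translated.\<close>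

type_synonym cell = "int \<times> int"

definition adjacent :: "cell \<Rightarrow> cell \<Rightarrow> bool" where
  "adjacent p q \<longleftrightarrow> \<bar>fst p - fst q\<bar> + \<bar>snd p - snd q\<bar> = 1"

definition cell_connected :: "cell set \<Rightarrow> bool" where
  "cell_connected P \<longleftrightarrow>
     (\<forall>p\<in>P. \<forall>q\<in>P. (p, q) \<in> {(c, d). c \<in> P \<and> d \<in> P \<and> adjacent c d}\<^sup>*)"

text \<open>
  Polyominoes are handled through representatives: a cell set satisfying the predicate below stands
  for its congruence class. Being an ancestor, being simpler and being a winner do not depend on the
  choice of representatives; for teams and their sizes see below.
\<close>

definition polyomino :: "cell set \<Rightarrow> bool" where
  "polyomino P \<longleftrightarrow> P \<noteq> {} \<and> cell_connected P"

text \<open>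
  The maps obtained from translations, rotations and reflections of the board: a signed permutation
  of the two coordinates followed by a translation.
\<close>

definition board_congruences :: "(cell \<Rightarrow> cell) set" where
  "board_congruences =
     {f. \<exists>a b s t. s \<in> {1, -1} \<and> t \<in> {1, -1} \<and>
        (f = (\<lambda>(x, y). (a + s * x, b + t * y)) \<or> f = (\<lambda>(x, y). (a + s * y, b + t * x)))}"

definition congruent :: "cell set \<Rightarrow> cell set \<Rightarrow> bool" where
  "congruent P Q \<longleftrightarrow> (\<exists>f\<in>board_congruences. Q = f ` P)"

definition ancestor :: "cell set \<Rightarrow> cell set \<Rightarrow> bool" (infix "\<sqsubseteq>" 50) where
  "P \<sqsubseteq> Q \<longleftrightarrow> (\<exists>P'. congruent P P' \<and> P' \<subseteq> Q)"

definition simpler :: "cell set set \<Rightarrow> cell set set \<Rightarrow> bool" (infix "\<preceq>" 50) where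
  "\<S> \<preceq> \<T> \<longleftrightarrow> (\<forall>Q\<in>\<T>. \<exists>P\<in>\<S>. P \<sqsubseteq> Q)"

text \<open>
  Congruent cell sets are ancestors of each other, so the members of a team represent pairwise
  different polyominoes and the cardinality of the set of representatives is the size of the team.
\<close>

definition team :: "cell set set \<Rightarrow> bool" where
  "team \<F> \<longleftrightarrow> (\<forall>P\<in>\<F>. polyomino P) \<and> (\<forall>P\<in>\<F>. \<forall>Q\<in>\<F>. P \<noteq> Q \<longrightarrow> \<not> P \<sqsubseteq> Q)"

text \<open>
  In round \<open>n\<close> (counted from 0) the maker marks the cell \<open>m n\<close>, and then the breaker marks the two
  cells of \<open>b n\<close>. A play is continued forever; the maker wins it if at some point he has marked a
  congruent copy of a member of \<open>\<S>\<close>, so the cells marked afterwards do not matter.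
\<close>

definition marked_before :: "(nat \<Rightarrow> cell) \<Rightarrow> (nat \<Rightarrow> cell set) \<Rightarrow> nat \<Rightarrow> cell set" where
  "marked_before m b n = m ` {..<n} \<union> (\<Union>k<n. b k)"

definition maker_legal :: "(nat \<Rightarrow> cell) \<Rightarrow> (nat \<Rightarrow> cell set) \<Rightarrow> nat \<Rightarrow> bool" where
  "maker_legal m b n \<longleftrightarrow> m n \<notin> marked_before m b n"

definition breaker_legal :: "(nat \<Rightarrow> cell) \<Rightarrow> (nat \<Rightarrow> cell set) \<Rightarrow> nat \<Rightarrow> bool" where
  "breaker_legal m b n \<longleftrightarrow> card (b n) = 2 \<and> b n \<inter> insert (m n) (marked_before m b n) = {}"

definition history :: "(nat \<Rightarrow> cell) \<Rightarrow> (nat \<Rightarrow> cell set) \<Rightarrow> nat \<Rightarrow> (cell \<times> cell set) list" where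
  "history m b n = map (\<lambda>k. (m k, b k)) [0..<n]"

definition maker_has_won :: "cell set set \<Rightarrow> (nat \<Rightarrow> cell) \<Rightarrow> nat \<Rightarrow> bool" where
  "maker_has_won \<S> m n \<longleftrightarrow> (\<exists>P\<in>\<S>. \<exists>Q. congruent P Q \<and> Q \<subseteq> m ` {..<n})"

definition winning_strategy :: "cell set set \<Rightarrow> ((cell \<times> cell set) list \<Rightarrow> cell) \<Rightarrow> bool" where
  "winning_strategy \<S> \<sigma> \<longleftrightarrow>
     (\<forall>m b. (\<forall>n. m n = \<sigma> (history m b n)) \<and> (\<forall>n. breaker_legal m b n) \<longrightarrow>
        (\<forall>n. maker_legal m b n) \<and> (\<exists>n. maker_has_won \<S> m n))"

definition unbounded :: "cell set set \<Rightarrow> bool" where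
  "unbounded \<T> \<longleftrightarrow> (\<exists>T\<in>\<T>. infinite T)"

definition bounded_restriction :: "cell set set \<Rightarrow> cell set set \<Rightarrow> bool" where
  "bounded_restriction \<T> \<R> \<longleftrightarrow>
     (\<exists>F. (\<forall>T\<in>\<T>. polyomino (F T) \<and> finite (F T) \<and> F T \<sqsubseteq> T) \<and> \<R> = F ` \<T>)"

text \<open>Bounded restrictions consist of finite polyominoes, so no recursion is needed.\<close>

definition winner :: "cell set set \<Rightarrow> bool" where
  "winner \<S> \<longleftrightarrow>
     (if unbounded \<S> then \<forall>\<R>. bounded_restriction \<S> \<R> \<longrightarrow> (\<exists>\<sigma>. winning_strategy \<R> \<sigma>)
      else \<exists>\<sigma>. winning_strategy \<S> \<sigma>)"

abbreviation loser :: "cell set set \<Rightarrow> bool" where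
  "loser \<S> \<equiv> \<not> winner \<S>"

definition S_poly :: "nat \<Rightarrow> cell set" where
  "S_poly n = (\<lambda>i. (int i, 0)) ` {..<n}"

definition L_poly :: "nat \<Rightarrow> cell set" where
  "L_poly n = S_poly n \<union> {(0, 1)}"

definition T2 :: "cell set" where
  "T2 = {(0, 0), (1, 0), (2, 0), (1, 1)}"

definition C2 :: "cell set" where
  "C2 = {(0, 0), (1, 0), (0, 1), (1, 1)}"

definition Z2 :: "cell set" where
  "Z2 = {(0, 0), (1, 0), (0, 1), (1, -1)}"

definition characterizing_losers :: "nat \<Rightarrow> cell set set set \<Rightarrow> bool" where
  "characterizing_losers k \<C> \<longleftrightarrow>
     (\<forall>\<N>\<in>\<C>. team \<N> \<and> loser \<N>) \<and>
     (\<forall>\<F>. team \<F> \<and> card \<F> = k \<longrightarrow> (\<exists>\<N>\<in>\<C>. \<N> \<preceq> \<F>))"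

end

theory Submission
  imports Defs
begin

text \<open>
  The breaker defeats each of the five sets by a pairing strategy: the cells are the vertices of a
  doubly periodic graph of maximal degree 2 such that every copy of a member of the set contains an
  edge. Marking the neighbours of each cell the maker marks, she never lets him own both ends of an
  edge.

  Suppose a team of size 4 lies above none of the five sets. The first three sets provide a member
  without \<open>L_2\<close>, one without \<open>S_3\<close> and \<open>Z_2\<close>, and one without \<open>S_3\<close> and \<open>C_2\<close>. These have to be a
  straight polyomino containing \<open>S_4\<close>, the square \<open>C_2\<close> and a staircase containing \<open>Z_2\<close>, because
  straight polyominoes are pairwise comparable, and so are staircases, even infinite ones. The
  fourth member is not straight, so it contains \<open>L_3\<close>, \<open>T_2\<close>, \<open>C_2\<close> or \<open>Z_2\<close>, and one of the last two
  sets is simpler than the team.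
\<close>

section \<open>Congruences of the board\<close>

text \<open>Splitting the signs gives eight explicit maps, so that automation meets linear terms in
  place of products with unknown signs.\<close>

lemma board_congruences_cases:
  assumes "f \<in> board_congruences"
  obtains a b where "f = (\<lambda>(x, y). (a + x, b + y))" | a b where "f = (\<lambda>(x, y). (a + x, b - y))"
    | a b where "f = (\<lambda>(x, y). (a - x, b + y))" | a b where "f = (\<lambda>(x, y). (a - x, b - y))"
    | a b where "f = (\<lambda>(x, y). (a + y, b + x))" | a b where "f = (\<lambda>(x, y). (a + y, b - x))"
    | a b where "f = (\<lambda>(x, y). (a - y, b + x))" | a b where "f = (\<lambda>(x, y). (a - y, b - x))"
proof -
  obtain a b s t where st: "s \<in> {1, -1}" "t \<in> {1, -1 :: int}"
    and f: "f = (\<lambda>(x, y). (a + s * x, b + t * y)) \<or> f = (\<lambda>(x, y). (a + s * y, b + t * x))"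
    using assms unfolding board_congruences_def by blast
  have "s = 1 \<or> s = -1" "t = 1 \<or> t = -1" using st by auto
  then show thesis using f that by auto
qed

lemma board_congruences_memI:
  "(\<lambda>(x, y). (a + x, b + y)) \<in> board_congruences" "(\<lambda>(x, y). (a + x, b - y)) \<in> board_congruences"
  "(\<lambda>(x, y). (a - x, b + y)) \<in> board_congruences" "(\<lambda>(x, y). (a - x, b - y)) \<in> board_congruences"
  "(\<lambda>(x, y). (a + y, b + x)) \<in> board_congruences" "(\<lambda>(x, y). (a + y, b - x)) \<in> board_congruences"
  "(\<lambda>(x, y). (a - y, b + x)) \<in> board_congruences" "(\<lambda>(x, y). (a - y, b - x)) \<in> board_congruences"
proof -
  have *: "s \<in> {1, -1} \<Longrightarrow> t \<in> {1, -1} \<Longrightarrow> (\<lambda>(x, y). (a + s * x, b + t * y)) \<in> board_congruences"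
    "s \<in> {1, -1} \<Longrightarrow> t \<in> {1, -1} \<Longrightarrow> (\<lambda>(x, y). (a + s * y, b + t * x)) \<in> board_congruences" for s t
    unfolding board_congruences_def by blast+
  show "(\<lambda>(x, y). (a + x, b + y)) \<in> board_congruences" "(\<lambda>(x, y). (a + x, b - y)) \<in> board_congruences"
    "(\<lambda>(x, y). (a - x, b + y)) \<in> board_congruences" "(\<lambda>(x, y). (a - x, b - y)) \<in> board_congruences"
    "(\<lambda>(x, y). (a + y, b + x)) \<in> board_congruences" "(\<lambda>(x, y). (a + y, b - x)) \<in> board_congruences"
    "(\<lambda>(x, y). (a - y, b + x)) \<in> board_congruences" "(\<lambda>(x, y). (a - y, b - x)) \<in> board_congruences"
    using *[of 1 1] *[of 1 "-1"] *[of "-1" 1] *[of "-1" "-1"] by simp_all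
qed

lemma board_congruences_id: "(\<lambda>c. c) \<in> board_congruences"
  using board_congruences_memI(1)[of 0 0] by (simp add: case_prod_unfold)

lemma board_congruences_comp:
  assumes "f \<in> board_congruences" "g \<in> board_congruences"
  shows "f \<circ> g \<in> board_congruences"
proof -
  obtain a b s t where st: "s \<in> {1, -1}" "t \<in> {1, -1 :: int}"
    and f: "f = (\<lambda>(x, y). (a + s * x, b + t * y)) \<or> f = (\<lambda>(x, y). (a + s * y, b + t * x))"
    using assms unfolding board_congruences_def by blast
  obtain a' b' s' t' where st': "s' \<in> {1, -1}" "t' \<in> {1, -1 :: int}"
    and g: "g = (\<lambda>(x, y). (a' + s' * x, b' + t' * y)) \<or> g = (\<lambda>(x, y). (a' + s' * y, b' + t' * x))"
    using assms unfolding board_congruences_def by blast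
  \<comment> \<open>If \<open>f\<close> swaps the coordinates, each of its signs meets the sign of
    the other coordinate of \<open>g\<close>; hence the mixed products.\<close>
  have *: "s * s' \<in> {1, -1}" "t * t' \<in> {1, -1}" "s * t' \<in> {1, -1}" "t * s' \<in> {1, -1}"
    using st st' by auto
  have I: "F \<in> board_congruences" if "s \<in> {1, -1}" "t \<in> {1, -1}"
    "(\<forall>x y. F (x, y) = (a + s * x, b + t * y)) \<or> (\<forall>x y. F (x, y) = (a + s * y, b + t * x))" for F a b s t
  proof -
    have "F = (\<lambda>(x, y). (a + s * x, b + t * y)) \<or> F = (\<lambda>(x, y). (a + s * y, b + t * x))"
      using that(3) by (auto simp: fun_eq_iff)
    then show ?thesis using that(1,2) unfolding board_congruences_def by blast
  qed
  from f g show ?thesis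
    apply (elim disjE)
    subgoal by (rule I[OF *(1,2), of _ "a + s * a'" "b + t * b'"]) (simp add: algebra_simps)
    subgoal by (rule I[OF *(1,2), of _ "a + s * a'" "b + t * b'"]) (simp add: algebra_simps)
    subgoal by (rule I[OF *(3,4), of _ "a + s * b'" "b + t * a'"]) (simp add: algebra_simps)
    subgoal by (rule I[OF *(3,4), of _ "a + s * b'" "b + t * a'"]) (simp add: algebra_simps)
    done
qed

text \<open>Each linear part is its own inverse, except for the two quarter turns (cases 6 and 7),
  which are inverse to each other.\<close>

lemma board_congruences_inverse:
  assumes "f \<in> board_congruences"
  obtains g where "g \<in> board_congruences" "\<And>c. g (f c) = c" "\<And>c. f (g c) = c"
  using assms
proof (cases rule: board_congruences_cases)
  case (1 a b)
  then show thesis by (intro that[OF board_congruences_memI(1)[of "-a" "-b"]]) auto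
next
  case (2 a b)
  then show thesis by (intro that[OF board_congruences_memI(2)[of "-a" b]]) auto
next
  case (3 a b)
  then show thesis by (intro that[OF board_congruences_memI(3)[of a "-b"]]) auto
next
  case (4 a b)
  then show thesis by (intro that[OF board_congruences_memI(4)[of a b]]) auto
next
  case (5 a b)
  then show thesis by (intro that[OF board_congruences_memI(5)[of "-b" "-a"]]) auto
next
  case (6 a b)
  then show thesis by (intro that[OF board_congruences_memI(7)[of b "-a"]]) auto
next
  case (7 a b)
  then show thesis by (intro that[OF board_congruences_memI(6)[of "-b" a]]) auto
next
  case (8 a b)
  then show thesis by (intro that[OF board_congruences_memI(8)[of b a]]) auto
qed

lemma bij_board_congruence: "f \<in> board_congruences \<Longrightarrow> bij f"
  by (metis board_congruences_inverse bijI')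

lemma adjacent_board_congruence:
  "f \<in> board_congruences \<Longrightarrow> adjacent (f p) (f q) \<longleftrightarrow> adjacent p q"
  by (erule board_congruences_cases) (auto simp: adjacent_def split: prod.splits)

lemma adjacent_sym: "adjacent p q \<longleftrightarrow> adjacent q p"
  by (simp add: adjacent_def abs_minus_commute)

section \<open>Ancestors and connected sets of cells\<close>

lemma ancestor_iff: "P \<sqsubseteq> Q \<longleftrightarrow> (\<exists>f\<in>board_congruences. f ` P \<subseteq> Q)"
  by (auto simp: ancestor_def congruent_def)

lemma ancestorI: "f \<in> board_congruences \<Longrightarrow> f ` P \<subseteq> Q \<Longrightarrow> P \<sqsubseteq> Q"
  by (auto simp: ancestor_iff)

lemma ancestor_mono: "P \<subseteq> Q \<Longrightarrow> P \<sqsubseteq> Q"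
  using ancestorI[OF board_congruences_id] by auto

lemma ancestor_trans: "P \<sqsubseteq> Q \<Longrightarrow> Q \<sqsubseteq> R \<Longrightarrow> P \<sqsubseteq> R"
  unfolding ancestor_iff
  by (metis board_congruences_comp image_comp image_mono subset_trans)

text \<open>Preimages serve to normalise: if \<open>f\<close> carries a pattern at the origin into
  \<open>P\<close>, then the preimage of \<open>P\<close> contains the pattern itself and is
  equivalent to \<open>P\<close> for the ancestor relation.\<close>

lemma ancestor_vimage:
  assumes "f \<in> board_congruences"
  shows "f -` P \<sqsubseteq> P" "P \<sqsubseteq> f -` P"
proof -
  show "f -` P \<sqsubseteq> P" using assms by (intro ancestorI[of f]) auto
  obtain g where "g \<in> board_congruences" "\<And>c. f (g c) = c"
    using assms by (rule board_congruences_inverse) auto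
  then show "P \<sqsubseteq> f -` P" by (intro ancestorI[of g]) auto
qed

lemma ancestor_vimage_iff:
  "f \<in> board_congruences \<Longrightarrow> Q \<sqsubseteq> f -` P \<longleftrightarrow> Q \<sqsubseteq> P"
  using ancestor_vimage ancestor_trans by blast

lemma ancestor_image:
  "f \<in> board_congruences \<Longrightarrow> f ` P \<sqsubseteq> P"
  using ancestor_vimage(2)[of f "f ` P"] bij_board_congruence[of f]
  by (simp add: bij_is_inj inj_vimage_image_eq)

section \<open>Connectedness through edges leaving a subset\<close>

lemma cell_connected_induct:
  assumes "cell_connected P" "p \<in> P" "q \<in> P" "R p"
    and step: "\<And>c d. R c \<Longrightarrow> c \<in> P \<Longrightarrow> d \<in> P \<Longrightarrow> adjacent c d \<Longrightarrow> R d"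
  shows "R q"
proof -
  have "(p, q) \<in> {(c, d). c \<in> P \<and> d \<in> P \<and> adjacent c d}\<^sup>*"
    using assms unfolding cell_connected_def by blast
  then show ?thesis by induction (use assms in auto)
qed

text \<open>Otherwise induction along edges, started in a cell of \<open>A\<close>, would never
  leave \<open>A\<close> and yet reach all of \<open>P\<close>.\<close>

lemma cell_connected_exit:
  assumes "cell_connected P" "A \<subseteq> P" "A \<noteq> {}" "\<not> P \<subseteq> A"
  obtains c d where "c \<in> A" "d \<in> P" "d \<notin> A" "adjacent c d"
  using cell_connected_induct[OF assms(1), of _ _ "\<lambda>c. c \<in> A"] assms by blast

text \<open>The hypothesis is applied to the set of cells reachable from a given cell within
  \<open>P\<close>.\<close>

lemma cell_connectedI:
  assumes "\<And>A. A \<subseteq> P \<Longrightarrow> A \<noteq> {} \<Longrightarrow> (\<And>c d. c \<in> A \<Longrightarrow> d \<in> P \<Longrightarrow> adjacent c d \<Longrightarrow> d \<in> A) \<Longrightarrow> P \<subseteq> A"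
  shows "cell_connected P"
  unfolding cell_connected_def
proof safe
  fix a b a' b' assume in_P: "(a, b) \<in> P" "(a', b') \<in> P"
  let ?R = "{(c, d). c \<in> P \<and> d \<in> P \<and> adjacent c d}"
  have "P \<subseteq> {c \<in> P. ((a, b), c) \<in> ?R\<^sup>*}"
    by (rule assms) (use in_P in \<open>auto intro: rtrancl_into_rtrancl\<close>)
  then show "((a, b), (a', b')) \<in> ?R\<^sup>*" using in_P by auto
qed

lemma polyomino_vimage:
  assumes "f \<in> board_congruences" "polyomino P"
  shows "polyomino (f -` P)"
proof -
  have bij: "bij f" using assms by (simp add: bij_board_congruence)
  have "cell_connected (f -` P)"
  proof (rule cell_connectedI)
    fix A assume A: "A \<subseteq> f -` P" "A \<noteq> {}"
      and closed: "\<And>c d. c \<in> A \<Longrightarrow> d \<in> f -` P \<Longrightarrow> adjacent c d \<Longrightarrow> d \<in> A"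
    show "f -` P \<subseteq> A"
    proof (rule ccontr)
      assume "\<not> f -` P \<subseteq> A"
      then have "\<not> P \<subseteq> f ` A"
        using bij by (metis bij_is_inj inj_vimage_image_eq vimage_mono)
      then obtain c d where cd: "c \<in> f ` A" "d \<in> P" "d \<notin> f ` A" "adjacent c d"
        using cell_connected_exit[of P "f ` A"] A assms(2) unfolding polyomino_def by blast
      obtain c' where c': "c = f c'" "c' \<in> A" using cd(1) by blast
      obtain d' where d': "d = f d'" using bij by (metis bij_pointE)
      have "d' \<in> A"
        using closed[OF c'(2), of d'] cd adjacent_board_congruence[OF assms(1)] c' d' by simp
      then show False using cd d' by blast
    qed
  qed
  moreover have "f -` P \<noteq> {}"
    using assms(2) bij unfolding polyomino_def by (simp add: bij_is_surj surj_vimage_empty)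
  ultimately show ?thesis by (simp add: polyomino_def)
qed

lemma polyomino_singleton: "polyomino {c}"
  unfolding polyomino_def by (auto intro!: cell_connectedI)

lemma polyomino_insert:
  assumes "polyomino P" "p \<in> P" "adjacent p c"
  shows "polyomino (insert c P)"
proof -
  have "cell_connected (insert c P)"
  proof (rule cell_connectedI)
    fix A assume A: "A \<subseteq> insert c P" "A \<noteq> {}"
      and closed: "\<And>x d. x \<in> A \<Longrightarrow> d \<in> insert c P \<Longrightarrow> adjacent x d \<Longrightarrow> d \<in> A"
    have "A \<inter> P \<noteq> {}"
      using A closed[of c p] assms adjacent_sym[of p c] by auto
    then have "P \<subseteq> A \<inter> P"
      using cell_connected_exit[of P "A \<inter> P"] assms(1) closed
      unfolding polyomino_def by (metis IntE IntI inf_le2 insertCI)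
    then show "insert c P \<subseteq> A" using closed[of p c] assms by auto
  qed
  then show ?thesis by (simp add: polyomino_def)
qed

section \<open>The small polyominoes and their comparison\<close>

lemma L_poly_2: "L_poly 2 = {(0, 0), (1, 0), (0, 1)}"
  by (auto simp: L_poly_def S_poly_def lessThan_Suc numeral_eq_Suc)

lemma L_poly_3: "L_poly 3 = {(0, 0), (1, 0), (2, 0), (0, 1)}"
  by (auto simp: L_poly_def S_poly_def lessThan_Suc numeral_eq_Suc)

lemma S_poly_3: "S_poly 3 = {(0, 0), (1, 0), (2, 0)}"
  by (auto simp: S_poly_def lessThan_Suc numeral_eq_Suc)

lemma S_poly_4: "S_poly 4 = {(0, 0), (1, 0), (2, 0), (3, 0)}"
  by (auto simp: S_poly_def lessThan_Suc numeral_eq_Suc)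

lemmas small_polys = L_poly_2 L_poly_3 S_poly_3 S_poly_4 T2_def C2_def Z2_def

lemma polyomino_small:
  "polyomino (L_poly 2)" "polyomino (L_poly 3)" "polyomino (S_poly 3)" "polyomino (S_poly 4)"
  "polyomino T2" "polyomino C2" "polyomino Z2"
proof -
  have c: "polyomino {(0, 0), (1, 0)}"
    using polyomino_insert[OF polyomino_singleton[of "(1, 0)"], of _ "(0, 0)"]
    by (simp add: adjacent_def)
  note i = polyomino_insert[unfolded adjacent_def]
  show L: "polyomino (L_poly 2)"
    using i[OF c, of "(0, 0)" "(0, 1)"] by (simp add: small_polys insert_commute)
  show S: "polyomino (S_poly 3)"
    using i[OF c, of "(1, 0)" "(2, 0)"] by (simp add: small_polys insert_commute)
  show "polyomino (S_poly 4)"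
    using i[OF S, of "(2, 0)" "(3, 0)"] by (simp add: small_polys insert_commute)
  show "polyomino (L_poly 3)"
    using i[OF S, of "(0, 0)" "(0, 1)"] by (simp add: small_polys insert_commute)
  show "polyomino T2"
    using i[OF S, of "(1, 0)" "(1, 1)"] by (simp add: small_polys insert_commute)
  show "polyomino C2"
    using i[OF L, of "(1, 0)" "(1, 1)"] by (simp add: small_polys insert_commute)
  show "polyomino Z2"
    using i[OF L, of "(1, 0)" "(1, -1)"] by (simp add: small_polys insert_commute)
qed

text \<open>A congruence is determined by the image \<open>(u, v)\<close> of the origin and one of
  eight linear parts. As the origin lies in \<open>P\<close>, its image lies in \<open>Q\<close>, so
  for explicit finite sets the simplifier faces a finite check.\<close>

lemma ancestor_iff_linear:
  assumes "(0, 0) \<in> P"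
  shows "P \<sqsubseteq> Q \<longleftrightarrow> (\<exists>(u, v)\<in>Q.
    (\<forall>(x, y)\<in>P. (u + x, v + y) \<in> Q) \<or> (\<forall>(x, y)\<in>P. (u + x, v - y) \<in> Q) \<or>
    (\<forall>(x, y)\<in>P. (u - x, v + y) \<in> Q) \<or> (\<forall>(x, y)\<in>P. (u - x, v - y) \<in> Q) \<or>
    (\<forall>(x, y)\<in>P. (u + y, v + x) \<in> Q) \<or> (\<forall>(x, y)\<in>P. (u + y, v - x) \<in> Q) \<or>
    (\<forall>(x, y)\<in>P. (u - y, v + x) \<in> Q) \<or> (\<forall>(x, y)\<in>P. (u - y, v - x) \<in> Q))"
    (is "_ \<longleftrightarrow> ?R")
proof
  assume "P \<sqsubseteq> Q"
  then obtain f where f: "f \<in> board_congruences" "f ` P \<subseteq> Q" by (auto simp: ancestor_iff)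
  from f(1) show ?R
    by (cases rule: board_congruences_cases) (use f(2) assms in \<open>(force simp: image_subset_iff)+\<close>)
next
  assume ?R
  then obtain u v where "(u, v) \<in> Q" and
    "(\<forall>(x, y)\<in>P. (u + x, v + y) \<in> Q) \<or> (\<forall>(x, y)\<in>P. (u + x, v - y) \<in> Q) \<or>
    (\<forall>(x, y)\<in>P. (u - x, v + y) \<in> Q) \<or> (\<forall>(x, y)\<in>P. (u - x, v - y) \<in> Q) \<or>
    (\<forall>(x, y)\<in>P. (u + y, v + x) \<in> Q) \<or> (\<forall>(x, y)\<in>P. (u + y, v - x) \<in> Q) \<or>
    (\<forall>(x, y)\<in>P. (u - y, v + x) \<in> Q) \<or> (\<forall>(x, y)\<in>P. (u - y, v - x) \<in> Q)"
    by blast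
  then show "P \<sqsubseteq> Q"
    apply (elim disjE)
    subgoal by (rule ancestorI[OF board_congruences_memI(1)[of u v]]) auto
    subgoal by (rule ancestorI[OF board_congruences_memI(2)[of u v]]) auto
    subgoal by (rule ancestorI[OF board_congruences_memI(3)[of u v]]) auto
    subgoal by (rule ancestorI[OF board_congruences_memI(4)[of u v]]) auto
    subgoal by (rule ancestorI[OF board_congruences_memI(5)[of u v]]) auto
    subgoal by (rule ancestorI[OF board_congruences_memI(6)[of u v]]) auto
    subgoal by (rule ancestorI[OF board_congruences_memI(7)[of u v]]) auto
    subgoal by (rule ancestorI[OF board_congruences_memI(8)[of u v]]) auto
    done
qed

text \<open>Both directions for every pair of polyominoes that occur together in one of the five
  sets; this makes the five sets teams.\<close>

lemma not_ancestor_small: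
  "\<not> S_poly 3 \<sqsubseteq> Z2" "\<not> Z2 \<sqsubseteq> S_poly 3" "\<not> S_poly 3 \<sqsubseteq> C2" "\<not> C2 \<sqsubseteq> S_poly 3"
  "\<not> S_poly 4 \<sqsubseteq> L_poly 3" "\<not> L_poly 3 \<sqsubseteq> S_poly 4" "\<not> S_poly 4 \<sqsubseteq> T2" "\<not> T2 \<sqsubseteq> S_poly 4"
  "\<not> S_poly 4 \<sqsubseteq> C2" "\<not> C2 \<sqsubseteq> S_poly 4" "\<not> S_poly 4 \<sqsubseteq> Z2" "\<not> Z2 \<sqsubseteq> S_poly 4"
  "\<not> L_poly 3 \<sqsubseteq> C2" "\<not> C2 \<sqsubseteq> L_poly 3" "\<not> L_poly 3 \<sqsubseteq> Z2" "\<not> Z2 \<sqsubseteq> L_poly 3"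
  "\<not> T2 \<sqsubseteq> C2" "\<not> C2 \<sqsubseteq> T2" "\<not> T2 \<sqsubseteq> Z2" "\<not> Z2 \<sqsubseteq> T2"
  "\<not> C2 \<sqsubseteq> Z2" "\<not> Z2 \<sqsubseteq> C2"
  by (simp_all add: small_polys ancestor_iff_linear)

lemma S3_ancestor:
  "S_poly 3 \<sqsubseteq> L_poly 3" "S_poly 3 \<sqsubseteq> T2"
  by (rule ancestor_mono, auto simp: small_polys)+

section \<open>Pairing strategies of the breaker\<close>

definition marked :: "(cell \<times> cell set) list \<Rightarrow> cell set" where
  "marked h = fst ` set h \<union> \<Union>(snd ` set h)"

text \<open>\<open>M\<close> stands for the marked cells. The breaker has to mark exactly two new
  cells, so the unmarked partners of \<open>c\<close> are padded with arbitrary unmarked cells if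
  they are fewer.\<close>

definition reply :: "(cell \<Rightarrow> cell set) \<Rightarrow> cell set \<Rightarrow> cell \<Rightarrow> cell set" where
  "reply G M c = (SOME B. card B = 2 \<and> B \<inter> M = {} \<and> G c - M \<subseteq> B)"

lemma reply:
  assumes "finite M" "finite (G c)" "card (G c) \<le> 2"
  shows "card (reply G M c) = 2" "reply G M c \<inter> M = {}" "G c \<subseteq> M \<union> reply G M c"
proof -
  have le: "card (G c - M) \<le> 2"
    using assms card_mono[of "G c" "G c - M"] by auto
  \<comment> \<open>The padding cells come from the infinite rest of the board.\<close>
  have "infinite (- (M \<union> G c))"
    using assms by (simp add: Compl_eq_Diff_UNIV infinite_UNIV_char_0 finite_prod)
  then obtain E where E: "E \<subseteq> - (M \<union> G c)" "finite E" "card E = 2 - card (G c - M)"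
    using infinite_arbitrarily_large by blast
  have "card ((G c - M) \<union> E) = 2"
    using E le assms by (subst card_Un_disjoint) auto
  then have "\<exists>B. card B = 2 \<and> B \<inter> M = {} \<and> G c - M \<subseteq> B"
    using E by (intro exI[of _ "(G c - M) \<union> E"]) auto
  from someI_ex[OF this]
  show "card (reply G M c) = 2" "reply G M c \<inter> M = {}" "G c \<subseteq> M \<union> reply G M c"
    unfolding reply_def by auto
qed

primrec play :: "((cell \<times> cell set) list \<Rightarrow> cell) \<Rightarrow> (cell \<Rightarrow> cell set) \<Rightarrow> nat \<Rightarrow> (cell \<times> cell set) list" where
  "play \<sigma> G 0 = []"
| "play \<sigma> G (Suc n) = (let h = play \<sigma> G n; c = \<sigma> h in h @ [(c, reply G (insert c (marked h)) c)])"

text \<open>\<open>G c\<close> is the set of partners of \<open>c\<close>. Once the round in which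
  the maker marks one end of an edge is over, the other end is marked too, so he cannot mark it
  later. By \<open>blocks\<close>, a complete copy would require both ends of some edge.\<close>

lemma no_winning_strategy_if_pairing:
  assumes fin: "\<And>c. finite (G c)" and card: "\<And>c. card (G c) \<le> 2"
    and irrefl: "\<And>c. c \<notin> G c" and sym: "\<And>c d. d \<in> G c \<Longrightarrow> c \<in> G d"
    and blocks: "\<And>P f. P \<in> \<S> \<Longrightarrow> f \<in> board_congruences \<Longrightarrow> \<exists>u\<in>P. \<exists>v\<in>P. f v \<in> G (f u)"
  shows "\<not> winning_strategy \<S> \<sigma>"
proof
  assume win: "winning_strategy \<S> \<sigma>"
  define m where "m n = \<sigma> (play \<sigma> G n)" for n
  define b where "b n = reply G (insert (m n) (marked (play \<sigma> G n))) (m n)" for n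
  have hist: "history m b n = play \<sigma> G n" for n
    by (induction n) (simp_all add: history_def Let_def m_def b_def)
  have marked: "marked (play \<sigma> G n) = marked_before m b n" for n
    unfolding hist[symmetric] by (auto simp: marked_def marked_before_def history_def image_image)
  have b: "b n = reply G (insert (m n) (marked_before m b n)) (m n)" for n
    using b_def[of n] marked[of n] by simp
  have "finite (marked_before m b n)" for n
  proof (induction n)
    case 0
    then show ?case by (simp add: marked_before_def)
  next
    case (Suc n)
    then have "finite (insert (m n) (marked_before m b n))" by simp
    from reply(1)[of _ G, OF this fin card] have "card (b n) = 2" by (simp only: b[of n])
    then have "finite (b n)" by (metis card.infinite zero_neq_numeral)
    moreover have "marked_before m b (Suc n) = insert (m n) (marked_before m b n) \<union> b n"
      by (auto simp: marked_before_def lessThan_Suc)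
    ultimately show ?case using Suc by simp
  qed
  then have fin': "finite (insert (m n) (marked_before m b n))" for n by simp
  note r = reply[of _ G, OF fin' fin card]
  have "breaker_legal m b n" for n
    unfolding breaker_legal_def using r(1,2)[of n] by (simp only: b[of n])
  moreover have "m n = \<sigma> (history m b n)" for n
    by (simp add: hist m_def)
  ultimately have legal: "\<And>n. maker_legal m b n" and "\<exists>n. maker_has_won \<S> m n"
    using win unfolding winning_strategy_def by blast+
  then obtain n P f where P: "P \<in> \<S>" and f: "f \<in> board_congruences" and sub: "f ` P \<subseteq> m ` {..<n}"
    unfolding maker_has_won_def congruent_def by blast
  obtain u v where uv: "u \<in> P" "v \<in> P" "f v \<in> G (f u)"
    using blocks[OF P f] by blast
  then obtain i j where ij: "f u = m i" "f v = m j" using sub by blast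
  \<comment> \<open>Round \<open>i\<close> leaves every partner of \<open>m i\<close> marked, so the
    later move to \<open>m j\<close> would be illegal. The case \<open>i = j\<close> is excluded by
    \<open>irrefl\<close>.\<close>
  have no: False if "i < j" "m j \<in> G (m i)" for i j
  proof -
    have "m j \<in> insert (m i) (marked_before m b i) \<union> b i"
      using r(3)[of "m i" i] that(2) b[of i] by blast
    then have "m j \<in> marked_before m b j"
      using that(1) unfolding marked_before_def by (auto dest: less_trans)
    then show False using legal[of j] by (simp add: maker_legal_def)
  qed
  have "m j \<in> G (m i)" "m i \<in> G (m j)" using uv ij sym by auto
  then show False using no[of i j] no[of j i] irrefl by (metis linorder_neqE_nat)
qed

text \<open>Every copy of a member of a set above \<open>\<N>\<close> contains a copy of a member of
  \<open>\<N>\<close>, so a strategy winning for the former wins for the latter. This disposes of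
  the five sets and of all teams above them at once, including unbounded ones.\<close>

lemma loser_if_no_winning_strategy:
  assumes "\<And>P. P \<in> \<N> \<Longrightarrow> polyomino P \<and> finite P"
    and no: "\<And>\<sigma>. \<not> winning_strategy \<N> \<sigma>" and le: "\<N> \<preceq> \<F>"
  shows "loser \<F>"
proof
  have transfer: False if "winning_strategy \<R> \<sigma>" "\<N> \<preceq> \<R>" for \<R> \<sigma>
  proof -
    have "maker_has_won \<N> m n" if "maker_has_won \<R> m n" for m n
    proof -
      obtain Q f where Q: "Q \<in> \<R>" "f \<in> board_congruences" "f ` Q \<subseteq> m ` {..<n}"
        using \<open>maker_has_won \<R> m n\<close> unfolding maker_has_won_def congruent_def by blast
      obtain P where P: "P \<in> \<N>" "P \<sqsubseteq> Q" using Q \<open>\<N> \<preceq> \<R>\<close> unfolding simpler_def by blast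
      then have "P \<sqsubseteq> m ` {..<n}"
        using Q ancestor_trans ancestorI by meson
      then show ?thesis using P unfolding maker_has_won_def ancestor_def by blast
    qed
    then have "winning_strategy \<N> \<sigma>"
      using that(1) unfolding winning_strategy_def by meson
    then show False using no by blast
  qed
  assume win: "winner \<F>"
  show False
  proof (cases "unbounded \<F>")
    case False
    then show False using win transfer le unfolding winner_def by auto
  next
    case True
    \<comment> \<open>A member of \<open>\<N>\<close> chosen below each member of
      \<open>\<F>\<close> yields a bounded restriction consisting of members of
      \<open>\<N>\<close>.\<close>
    have "\<forall>T\<in>\<F>. \<exists>P\<in>\<N>. P \<sqsubseteq> T" using le by (simp add: simpler_def)
    then obtain F where F: "\<forall>T\<in>\<F>. F T \<in> \<N> \<and> F T \<sqsubseteq> T" by metis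
    then have "bounded_restriction \<F> (F ` \<F>)"
      unfolding bounded_restriction_def using assms(1) by blast
    then obtain \<sigma> where "winning_strategy (F ` \<F>) \<sigma>" using win True unfolding winner_def by auto
    moreover have "\<N> \<preceq> F ` \<F>"
      unfolding simpler_def using F ancestor_mono by blast
    ultimately show False using transfer by blast
  qed
qed

text \<open>
  The partners of a cell are given by a list \<open>N\<close> of offsets depending on its coordinates modulo \<open>k\<close>.
  The hypotheses are then closed formulas with bounded quantifiers, which can be evaluated.
\<close>

lemma no_winning_strategy_if_periodic_pairing:
  fixes k :: int and N :: "cell \<Rightarrow> cell list"
  assumes k: "k > 0"
    and N: "\<forall>i\<in>set [0..k - 1]. \<forall>j\<in>set [0..k - 1]. length (N (i, j)) \<le> 2 \<and>
      (\<forall>(x, y)\<in>set (N (i, j)).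
        (x, y) \<noteq> (0, 0) \<and> (- x, - y) \<in> set (N ((i + x) mod k, (j + y) mod k)))"
    and blocks: "\<forall>P\<in>\<S>. \<forall>i\<in>set [0..k - 1]. \<forall>j\<in>set [0..k - 1]. \<forall>s\<in>{1, -1}. \<forall>t\<in>{1, -1}.
      (\<exists>(x, y)\<in>P. \<exists>(x', y')\<in>P.
        (s * (x' - x), t * (y' - y)) \<in> set (N ((i + s * x) mod k, (j + t * y) mod k))) \<and>
      (\<exists>(x, y)\<in>P. \<exists>(x', y')\<in>P.
        (s * (y' - y), t * (x' - x)) \<in> set (N ((i + s * y) mod k, (j + t * x) mod k)))"
  shows "\<not> winning_strategy \<S> \<sigma>"
proof -
  define G where "G c = (\<lambda>(x, y). (fst c + x, snd c + y)) ` set (N (fst c mod k, snd c mod k))" for c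
  have mem: "i mod k \<in> set [0..k - 1]" for i using k by simp
  have NI: "length (N (i mod k, j mod k)) \<le> 2"
    "(x, y) \<in> set (N (i mod k, j mod k)) \<Longrightarrow> (x, y) \<noteq> (0, 0) \<and>
      (- x, - y) \<in> set (N ((i + x) mod k, (j + y) mod k))" for i j x y
    using bspec[OF bspec[OF N mem[of i]] mem[of j], unfolded mod_add_left_eq] by blast+
  have G_iff: "(x', y') \<in> G (x, y) \<longleftrightarrow> (x' - x, y' - y) \<in> set (N (x mod k, y mod k))" for x y x' y'
  proof -
    have "(x', y') \<in> G (x, y) \<longleftrightarrow>
        (\<exists>d\<in>set (N (x mod k, y mod k)). (x', y') = (x + fst d, y + snd d))"
      by (simp add: G_def image_iff case_prod_unfold)
    also have "\<dots> \<longleftrightarrow> (\<exists>d\<in>set (N (x mod k, y mod k)). d = (x' - x, y' - y))"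
      by (intro bex_cong) auto
    finally show ?thesis by blast
  qed
  show ?thesis
  proof (rule no_winning_strategy_if_pairing[of G])
    show "finite (G c)" for c by (simp add: G_def)
    show "card (G c) \<le> 2" for c
      unfolding G_def using NI(1)
      by (meson card_image_le card_length finite_set le_trans)
    show "c \<notin> G c" for c
      using NI(2)[of 0 0 "fst c" "snd c"] G_iff[of "fst c" "snd c" "fst c" "snd c"] by auto
    show "c \<in> G d" if "d \<in> G c" for c d
    proof -
      obtain x y x' y' where c: "c = (x, y)" "d = (x', y')" by fastforce
      then show ?thesis using that NI(2)[of "x' - x" "y' - y" x y] by (simp add: G_iff)
    qed
    fix P f assume P: "P \<in> \<S>" and "f \<in> board_congruences"
    then obtain a b s t where st: "s \<in> {1, -1}" "t \<in> {1, -1 :: int}"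
      and f: "f = (\<lambda>(x, y). (a + s * x, b + t * y)) \<or> f = (\<lambda>(x, y). (a + s * y, b + t * x))"
      unfolding board_congruences_def by blast
    \<comment> \<open>Only the residues of the translation vector \<open>(a, b)\<close> matter, so
      finitely many cases cover all congruences.\<close>
    note * = bspec[OF bspec[OF bspec[OF bspec[OF bspec[OF blocks P] mem[of a]] mem[of b]] st(1)] st(2),
      unfolded mod_add_left_eq]
    from f show "\<exists>u\<in>P. \<exists>v\<in>P. f v \<in> G (f u)"
    proof
      assume f: "f = (\<lambda>(x, y). (a + s * x, b + t * y))"
      obtain x y x' y' where "(x, y) \<in> P" "(x', y') \<in> P"
        "(s * (x' - x), t * (y' - y)) \<in> set (N ((a + s * x) mod k, (b + t * y) mod k))"
        using conjunct1[OF *] by blast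
      then show ?thesis unfolding f
        by (intro bexI[of _ "(x, y)"] bexI[of _ "(x', y')"]) (simp_all add: G_iff right_diff_distrib)
    next
      assume f: "f = (\<lambda>(x, y). (a + s * y, b + t * x))"
      obtain x y x' y' where "(x, y) \<in> P" "(x', y') \<in> P"
        "(s * (y' - y), t * (x' - x)) \<in> set (N ((a + s * y) mod k, (b + t * x) mod k))"
        using conjunct2[OF *] by blast
      then show ?thesis unfolding f
        by (intro bexI[of _ "(x, y)"] bexI[of _ "(x', y')"]) (simp_all add: G_iff right_diff_distrib)
    qed
  qed
qed

section \<open>The five pairings\<close>

text \<open>The edges are all horizontal adjacencies; every copy of \<open>L_poly 2\<close> contains
  one.\<close>

lemma no_win_L2: "\<not> winning_strategy {L_poly 2} \<sigma>"
  by (rule no_winning_strategy_if_periodic_pairing[where k = 1 and N = "\<lambda>_. [(1, 0), (-1, 0)]"])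
    code_simp+

text \<open>The graph consists of 4-cycles around the blocks of a tiling by 2 by 2 squares. Three
  cells in a line have two in one block, and the two parallel dominoes of \<open>Z2\<close> are
  offset by one, so one of them lies in a block.\<close>

lemma no_win_S3_Z2: "\<not> winning_strategy {S_poly 3, Z2} \<sigma>"
  by (rule no_winning_strategy_if_periodic_pairing[where k = 2 and
      N = "\<lambda>(i, j). [(if i = 0 then 1 else -1, 0), (0, if j = 0 then 1 else -1)]"])
    code_simp+

text \<open>The vertical pairs are now shifted by one in every other column, giving paths that
  meander along strips of width two. Of the two vertical dominoes in a square, one is therefore an
  edge.\<close>

lemma no_win_S3_C2: "\<not> winning_strategy {S_poly 3, C2} \<sigma>"
  by (rule no_winning_strategy_if_periodic_pairing[where k = 2 and
      N = "\<lambda>(i, j). [(if i = 0 then 1 else -1, 0), (0, if i = j then 1 else -1)]"])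
    code_simp+

text \<open>Modulo 3, the cells with \<open>i - j = 0\<close> form diagonal paths, and the two
  diagonals between them form a staircase path. Three cells in a line without an edge have their
  middle in class 0; the extra cell of \<open>L_poly 3\<close> then completes a diagonal or a
  staircase edge.\<close>

lemma no_win_S4_L3_C2_Z2: "\<not> winning_strategy {S_poly 4, L_poly 3, C2, Z2} \<sigma>"
  by (rule no_winning_strategy_if_periodic_pairing[where k = 3 and
      N = "\<lambda>(i, j). if (i - j) mod 3 = 0 then [(1, 1), (-1, -1)]
        else if (i - j) mod 3 = 1 then [(1, 0), (0, -1)] else [(-1, 0), (0, 1)]"])
    code_simp+

text \<open>The paths are staircases with steps of length two. A horizontal triple without an edge
  has its middle in class 0 of \<open>i - j\<close> modulo 4, whose vertical neighbours are both
  partners; a vertical one has it in class 2, whose horizontal neighbours are. This handles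
  \<open>T2\<close>.\<close>

lemma no_win_S4_T2_C2_Z2: "\<not> winning_strategy {S_poly 4, T2, C2, Z2} \<sigma>"
  by (rule no_winning_strategy_if_periodic_pairing[where k = 4 and
      N = "\<lambda>(i, j). if (i - j) mod 4 = 0 then [(0, 1), (0, -1)]
        else if (i - j) mod 4 = 1 then [(1, 0), (0, 1)]
        else if (i - j) mod 4 = 2 then [(1, 0), (-1, 0)] else [(-1, 0), (0, -1)]"])
    code_simp+

section \<open>Straight polyominoes and staircases\<close>

definition int_interval :: "int set \<Rightarrow> bool" where
  "int_interval I \<longleftrightarrow> I \<noteq> {} \<and> (\<forall>a\<in>I. \<forall>b\<in>I. {a..b} \<subseteq> I)"

text \<open>The first alternative provides \<open>n + 1\<close> consecutive elements, the second
  leaves room for at most \<open>n\<close>. In the second case all distances are below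
  \<open>n\<close>, so there is a minimum to start from.\<close>

lemma int_interval_length:
  fixes n :: int
  assumes I: "int_interval I" and n: "n \<ge> 1"
  shows "(\<exists>a. {a..a + n} \<subseteq> I) \<or> (\<exists>a. I \<subseteq> {a..<a + n})"
proof (cases "\<exists>a\<in>I. \<exists>b\<in>I. b - a \<ge> n")
  case True
  then obtain a b where ab: "a \<in> I" "b \<in> I" "b - a \<ge> n" by blast
  then have "{a..a + n} \<subseteq> {a..b}" by auto
  then show ?thesis using I ab unfolding int_interval_def by blast
next
  case False
  obtain c where c: "c \<in> I" using I unfolding int_interval_def by blast
  have "I \<subseteq> {c - n..c + n}" using False c by force
  then have fin: "finite I" using finite_subset by blast
  then have "Min I \<in> I" using c by (intro Min_in) auto
  then have "I \<subseteq> {Min I..<Min I + n}" using False fin by force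
  then show ?thesis by blast
qed

lemma int_interval_cases:
  assumes "int_interval I"
  obtains "I = UNIV" | a where "I = {a..}" | a where "I = {..a}" | a n where "n \<ge> 1" "I = {a..<a + n}"
proof -
  have mem: "c \<in> I" if "a \<in> I" "b \<in> I" "a \<le> c" "c \<le> b" for a b c
    using assms that unfolding int_interval_def by fastforce
  obtain i where i: "i \<in> I" using assms unfolding int_interval_def by blast
  have below: "\<exists>a\<in>I. I \<subseteq> {a..}" if "I \<subseteq> {l..}" for l
  proof -
    have fin: "finite (I \<inter> {..i})" by (rule finite_subset[of _ "{l..i}"]) (use that in auto)
    define a where "a = Min (I \<inter> {..i})"
    have a: "a \<in> I \<inter> {..i}" unfolding a_def using fin i by (intro Min_in) auto
    have "a \<le> c" if "c \<in> I" for c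
      using that a Min_le[OF fin, of c] unfolding a_def[symmetric] by (cases "c \<le> i") auto
    then show ?thesis using a by auto
  qed
  have above: "\<exists>b\<in>I. I \<subseteq> {..b}" if "I \<subseteq> {..u}" for u
  proof -
    have fin: "finite (I \<inter> {i..})" by (rule finite_subset[of _ "{i..u}"]) (use that in auto)
    define b where "b = Max (I \<inter> {i..})"
    have b: "b \<in> I \<inter> {i..}" unfolding b_def using fin i by (intro Max_in) auto
    have "c \<le> b" if "c \<in> I" for c
      using that b Max_ge[OF fin, of c] unfolding b_def[symmetric] by (cases "i \<le> c") auto
    then show ?thesis using b by auto
  qed
  show thesis
  proof (cases "\<exists>l. I \<subseteq> {l..}"; cases "\<exists>u. I \<subseteq> {..u}")
    assume "\<exists>l. I \<subseteq> {l..}" "\<exists>u. I \<subseteq> {..u}"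
    then obtain a b where ab: "a \<in> I" "b \<in> I" "I \<subseteq> {a..}" "I \<subseteq> {..b}" using below above by metis
    then have "I = {a..<a + (b + 1 - a)}" using mem[OF ab(1,2)] ab(3,4) by auto
    moreover have "b + 1 - a \<ge> 1" using ab by auto
    ultimately show thesis using that(4) by blast
  next
    assume "\<exists>l. I \<subseteq> {l..}" and u: "\<nexists>u. I \<subseteq> {..u}"
    then obtain a where a: "a \<in> I" "I \<subseteq> {a..}" using below by metis
    have "c \<in> I" if "a \<le> c" for c
    proof -
      obtain d where "d \<in> I" "\<not> d \<le> c" using u by blast
      then show ?thesis using mem[OF a(1), of d c] that by simp
    qed
    then have "I = {a..}" using a by auto
    then show thesis by (rule that(2))
  next
    assume l: "\<nexists>l. I \<subseteq> {l..}" and "\<exists>u. I \<subseteq> {..u}"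
    then obtain a where a: "a \<in> I" "I \<subseteq> {..a}" using above by metis
    have "c \<in> I" if "c \<le> a" for c
    proof -
      obtain d where "d \<in> I" "\<not> c \<le> d" using l by blast
      then show ?thesis using mem[of d a c] a that by simp
    qed
    then have "I = {..a}" using a by auto
    then show thesis by (rule that(3))
  next
    assume l: "\<nexists>l. I \<subseteq> {l..}" and u: "\<nexists>u. I \<subseteq> {..u}"
    have "c \<in> I" for c
    proof -
      obtain d where "d \<in> I" "\<not> c \<le> d" using l by blast
      moreover obtain e where "e \<in> I" "\<not> e \<le> c" using u by blast
      ultimately show ?thesis using mem[of d e c] by simp
    qed
    then show thesis using that(1) by blast
  qed
qed

definition int_isometry :: "(int \<Rightarrow> int) \<Rightarrow> bool" where
  "int_isometry h \<longleftrightarrow> (\<exists>k. h = (\<lambda>i. k + i) \<or> h = (\<lambda>i. k - i))"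

text \<open>A finite interval is compared with any other by length, the whole line contains
  everything, and two half-lines are congruent, by a reflection if they point in opposite
  directions.\<close>

lemma int_interval_comparable:
  assumes I: "int_interval I" and J: "int_interval J"
  shows "\<exists>h. int_isometry h \<and> (h ` I \<subseteq> J \<or> h ` J \<subseteq> I)"
proof -
  have shift: "int_isometry (\<lambda>i. k + i)" and flip: "int_isometry (\<lambda>i. k - i)" for k
    by (auto simp: int_isometry_def)
  have finite_case: "\<exists>h. int_isometry h \<and> (h ` {a..<a + n} \<subseteq> J \<or> h ` J \<subseteq> {a..<a + n})"
    if J: "int_interval J" and n: "n \<ge> 1" for a n J
    using int_interval_length[OF J n]
  proof
    assume "\<exists>b. {b..b + n} \<subseteq> J"
    then obtain b where "{b..b + n} \<subseteq> J" ..
    then have "(\<lambda>i. (b - a) + i) ` {a..<a + n} \<subseteq> J" by force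
    then show ?thesis using shift by blast
  next
    assume "\<exists>b. J \<subseteq> {b..<b + n}"
    then obtain b where "J \<subseteq> {b..<b + n}" ..
    then have "(\<lambda>i. (a - b) + i) ` J \<subseteq> {a..<a + n}" by force
    then show ?thesis using shift by blast
  qed
  from I show ?thesis
  proof (cases rule: int_interval_cases)
    case 1
    then show ?thesis using shift by blast
  next
    case 4
    then show ?thesis using finite_case[OF J] by simp
  next
    case Ia: (2 a)
    from J show ?thesis
    proof (cases rule: int_interval_cases)
      case 1
      then show ?thesis using shift by blast
    next
      case (2 b)
      then have "(\<lambda>i. (b - a) + i) ` I \<subseteq> J" using Ia by auto
      then show ?thesis using shift by blast
    next
      case (3 b)
      then have "(\<lambda>i. (b + a) - i) ` I \<subseteq> J" using Ia by auto
      then show ?thesis using flip by blast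
    next
      case 4
      then show ?thesis using finite_case[OF I] by blast
    qed
  next
    case Ia: (3 a)
    from J show ?thesis
    proof (cases rule: int_interval_cases)
      case 1
      then show ?thesis using shift by blast
    next
      case (2 b)
      then have "(\<lambda>i. (b + a) - i) ` I \<subseteq> J" using Ia by auto
      then show ?thesis using flip by blast
    next
      case (3 b)
      then have "(\<lambda>i. (b - a) + i) ` I \<subseteq> J" using Ia by auto
      then show ?thesis using shift by blast
    next
      case 4
      then show ?thesis using finite_case[OF I] by blast
    qed
  qed
qed

section \<open>Lines and staircases as curves with all symmetries of the integers\<close>

definition line :: "int \<Rightarrow> cell" where
  "line i = (i, 0)"

text \<open>The curve alternately moves up and left; \<open>L_poly 2\<close> is its piece with
  indices -1, 0, 1, and the index of a cell \<open>(x, y)\<close> on it is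
  \<open>y - x\<close>.\<close>

definition stair :: "int \<Rightarrow> cell" where
  "stair i = (- (i div 2), (i + 1) div 2)"

text \<open>The last condition lets every isometry of the indices be realised on the board, so
  comparing pieces of the curve reduces to comparing index sets.\<close>

definition homogeneous_curve :: "(int \<Rightarrow> cell) \<Rightarrow> bool" where
  "homogeneous_curve \<gamma> \<longleftrightarrow> inj \<gamma> \<and>
     (\<forall>i j. adjacent (\<gamma> i) (\<gamma> j) \<longrightarrow> \<bar>i - j\<bar> = 1) \<and>
     (\<forall>h. int_isometry h \<longrightarrow> (\<exists>f\<in>board_congruences. \<forall>i. \<gamma> (h i) = f (\<gamma> i)))"

lemma homogeneous_line: "homogeneous_curve line"
  unfolding homogeneous_curve_def
proof (intro conjI allI impI)
  show "inj line" by (simp add: inj_def line_def)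
  show "\<bar>i - j\<bar> = 1" if "adjacent (line i) (line j)" for i j
    using that by (simp add: adjacent_def line_def)
  fix h assume "int_isometry h"
  then obtain k where "h = (\<lambda>i. k + i) \<or> h = (\<lambda>i. k - i)" unfolding int_isometry_def by blast
  then show "\<exists>f\<in>board_congruences. \<forall>i. line (h i) = f (line i)"
    using bexI[OF _ board_congruences_memI(1)[of k 0]] bexI[OF _ board_congruences_memI(3)[of k 0]]
    by (auto simp: line_def)
qed

lemma homogeneous_stair: "homogeneous_curve stair"
  unfolding homogeneous_curve_def
proof (intro conjI allI impI)
  show "inj stair"
  proof (rule injI)
    fix i j assume "stair i = stair j"
    then have "i div 2 = j div 2" "(i + 1) div 2 = (j + 1) div 2" by (simp_all add: stair_def)
    then show "i = j" by presburger
  qed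
  show "\<bar>i - j\<bar> = 1" if "adjacent (stair i) (stair j)" for i j
  proof -
    have "\<bar>i div 2 - j div 2\<bar> + \<bar>(i + 1) div 2 - (j + 1) div 2\<bar> = 1"
      using that by (simp add: adjacent_def stair_def abs_minus_commute)
    moreover have "i div 2 + (i + 1) div 2 = i" "j div 2 + (j + 1) div 2 = j" by presburger+
    moreover have "\<bar>(a + b) - (c + d)\<bar> = 1" if "\<bar>a - c\<bar> + \<bar>b - d\<bar> = 1" for a b c d :: int
      using that by linarith
    ultimately show ?thesis by metis
  qed
  fix h assume "int_isometry h"
  then obtain k where h: "h = (\<lambda>i. k + i) \<or> h = (\<lambda>i. k - i)" unfolding int_isometry_def by blast
  obtain m where "k = 2 * m \<or> k = 2 * m + 1" by (metis oddE evenE)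
  \<comment> \<open>The four cases are realised by a translation, a glide reflection along the
    staircase, a reflection in a line of slope 1 and a half-turn.\<close>
  then consider "h = (\<lambda>i. 2 * m + i)" | "h = (\<lambda>i. 2 * m + 1 + i)"
    | "h = (\<lambda>i. 2 * m - i)" | "h = (\<lambda>i. 2 * m + 1 - i)" using h by blast
  then show "\<exists>f\<in>board_congruences. \<forall>i. stair (h i) = f (stair i)"
  proof cases
    case 1
    then show ?thesis
      by (intro bexI[OF _ board_congruences_memI(1)[of "- m" m]]) (simp add: stair_def; presburger)
  next
    case 2
    then show ?thesis
      by (intro bexI[OF _ board_congruences_memI(8)[of "- m" "m + 1"]]) (simp add: stair_def; presburger)
  next
    case 3
    then show ?thesis
      by (intro bexI[OF _ board_congruences_memI(5)[of "- m" m]]) (simp add: stair_def; presburger)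
  next
    case 4
    then show ?thesis
      by (intro bexI[OF _ board_congruences_memI(4)[of "- m" "m + 1"]]) (simp add: stair_def; presburger)
  qed
qed

text \<open>A connected subset of the curve cannot skip an index.\<close>

lemma int_interval_of_curve:
  assumes \<gamma>: "homogeneous_curve \<gamma>" and P: "polyomino P" and sub: "P \<subseteq> range \<gamma>"
  obtains I where "int_interval I" "P = \<gamma> ` I"
proof
  define I where "I = \<gamma> -` P"
  show PI: "P = \<gamma> ` I" unfolding I_def using sub by blast
  have conn: "cell_connected P" using P by (simp add: polyomino_def)
  have "c \<in> I" if "a \<in> I" "b \<in> I" "c \<in> {a..b}" for a b c
  proof (rule ccontr)
    assume c: "c \<notin> I"
    \<comment> \<open>Indices change by one along an edge, so a path in \<open>P\<close> starting
      below the missing index \<open>c\<close> stays below it; but it has to reach \<open>b\<close>,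
      which is above.\<close>
    have "\<exists>i < c. \<gamma> i = \<gamma> b"
    proof (rule cell_connected_induct[OF conn, where p = "\<gamma> a" and R = "\<lambda>q. \<exists>i < c. \<gamma> i = q"])
      show "\<exists>i < c. \<gamma> i = \<gamma> a" using that c by (intro exI[of _ a]) (auto simp: order_less_le)
      fix p d assume p: "\<exists>i < c. \<gamma> i = p" "p \<in> P" and d: "d \<in> P" "adjacent p d"
      then obtain i j where ij: "i < c" "\<gamma> i = p" "\<gamma> j = d" using PI by blast
      then have "\<bar>i - j\<bar> = 1" using \<gamma> d unfolding homogeneous_curve_def by blast
      moreover have "j \<noteq> c" using c d ij unfolding I_def by auto
      ultimately show "\<exists>i < c. \<gamma> i = d" using ij by (intro exI[of _ j]) auto
    qed (use that in \<open>auto simp: I_def\<close>)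
    then obtain i where i: "i < c" "\<gamma> i = \<gamma> b" by blast
    then have "i = b" using \<gamma> by (simp add: homogeneous_curve_def inj_def)
    then show False using i that by simp
  qed
  moreover have "I \<noteq> {}" using P PI by (auto simp: polyomino_def)
  ultimately show "int_interval I" unfolding int_interval_def by blast
qed


lemma curve_comparable:
  assumes \<gamma>: "homogeneous_curve \<gamma>" and I: "int_interval I" and J: "int_interval J"
  shows "\<gamma> ` I \<sqsubseteq> \<gamma> ` J \<or> \<gamma> ` J \<sqsubseteq> \<gamma> ` I"
proof -
  obtain h where h: "int_isometry h" "h ` I \<subseteq> J \<or> h ` J \<subseteq> I"
    using int_interval_comparable[OF I J] by blast
  obtain f where f: "f \<in> board_congruences" "\<And>i. \<gamma> (h i) = f (\<gamma> i)"
    using \<gamma> h(1) unfolding homogeneous_curve_def by blast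
  have "f ` \<gamma> ` K = \<gamma> ` h ` K" for K using f(2) by (simp add: image_image)
  then show ?thesis using h(2) ancestorI[OF f(1)] by (metis image_mono)
qed

section \<open>Straight polyominoes\<close>

text \<open>Without a bend, all cells continue the line of the first two. A single cell is treated
  apart, since it determines no direction.\<close>

lemma straight_representation:
  assumes P: "polyomino P" and free: "\<not> L_poly 2 \<sqsubseteq> P"
  obtains I where "int_interval I" "P \<sqsubseteq> line ` I" "line ` I \<sqsubseteq> P"
proof -
  have conn: "cell_connected P" using P by (simp add: polyomino_def)
  obtain c where c: "c \<in> P" using P by (auto simp: polyomino_def)
  show thesis
  proof (cases "P \<subseteq> {c}")
    case True
    then have "P = {c}" using c by auto
    then have "(\<lambda>(x, y). (fst c + x, snd c + y)) ` line ` {0} = P" by (simp add: line_def)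
    then have "line ` {0} \<sqsubseteq> P \<and> P \<sqsubseteq> line ` {0}"
      by (metis ancestorI ancestor_image ancestor_vimage(2) bij_board_congruence bij_is_inj
          board_congruences_memI(1) inj_vimage_image_eq order_refl)
    then show ?thesis using that[of "{0}"] by (simp add: int_interval_def)
  next
    case False
    then obtain d where d: "d \<in> P" "adjacent c d"
      using cell_connected_exit[OF conn, of "{c}"] c by blast
    obtain x y x' y' where xy: "c = (x, y)" "d = (x', y')" by fastforce
    then have "(x' = x + 1 \<and> y' = y) \<or> (x' = x - 1 \<and> y' = y) \<or> (x' = x \<and> y' = y + 1) \<or> (x' = x \<and> y' = y - 1)"
      using d(2) by (auto simp: adjacent_def)
    then have "\<exists>f\<in>board_congruences. f (0, 0) = c \<and> f (1, 0) = d"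
    proof (elim disjE conjE)
      assume "x' = x + 1" "y' = y"
      then show ?thesis using xy by (intro bexI[OF _ board_congruences_memI(1)[of x y]]) simp
    next
      assume "x' = x - 1" "y' = y"
      then show ?thesis using xy by (intro bexI[OF _ board_congruences_memI(3)[of x y]]) simp
    next
      assume "x' = x" "y' = y + 1"
      then show ?thesis using xy by (intro bexI[OF _ board_congruences_memI(5)[of x y]]) simp
    next
      assume "x' = x" "y' = y - 1"
      then show ?thesis using xy by (intro bexI[OF _ board_congruences_memI(6)[of x y]]) simp
    qed
    then obtain f where f: "f \<in> board_congruences" "f (0, 0) = c" "f (1, 0) = d" by blast
    define Q where "Q = f -` P"
    have Q: "polyomino Q" "P \<sqsubseteq> Q" "Q \<sqsubseteq> P" "(0, 0) \<in> Q" "(1, 0) \<in> Q"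
      unfolding Q_def using f P c d by (simp_all add: polyomino_vimage ancestor_vimage)
    have "\<not> L_poly 2 \<sqsubseteq> Q" using free f(1) by (simp add: Q_def ancestor_vimage_iff)
    then have no: "\<not> ((x, y) \<in> Q \<and> (x + s, y) \<in> Q \<and> (x, y + t) \<in> Q)"
      if "s \<in> {1, -1}" "t \<in> {1, -1}" for x y s t
    proof -
      have "(\<lambda>(u, v). (x + s * u, y + t * v)) \<in> board_congruences"
        using that unfolding board_congruences_def by blast
      from ancestorI[OF this, of "L_poly 2" Q] show ?thesis
        using \<open>\<not> L_poly 2 \<sqsubseteq> Q\<close> by (auto simp: small_polys)
    qed
    \<comment> \<open>The horizontal neighbour is carried along in the induction because a vertical
      neighbour would form an \<open>L_poly 2\<close> with it.\<close>
    have "\<exists>x. q = (x, 0) \<and> ((x + 1, 0) \<in> Q \<or> (x - 1, 0) \<in> Q)" if q: "q \<in> Q" for q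
    proof (rule cell_connected_induct[where p = "(0, 0)" and P = Q])
      show "cell_connected Q" using Q(1) by (simp add: polyomino_def)
      fix p r
      assume p: "\<exists>x. p = (x, 0) \<and> ((x + 1, 0) \<in> Q \<or> (x - 1, 0) \<in> Q)" "p \<in> Q"
        and r: "r \<in> Q" "adjacent p r"
      then obtain x where x: "p = (x, 0)" "(x + 1, 0) \<in> Q \<or> (x - 1, 0) \<in> Q" by blast
      have "r = (x + 1, 0) \<or> r = (x - 1, 0) \<or> r = (x, 1) \<or> r = (x, -1)"
        using r(2) x(1) by (cases r) (auto simp: adjacent_def)
      moreover have "(x, 1) \<notin> Q" "(x, -1) \<notin> Q"
        using no[of 1 1 x 0] no[of "-1" 1 x 0] no[of 1 "-1" x 0] no[of "-1" "-1" x 0] x p(2) by auto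
      ultimately show "\<exists>x. r = (x, 0) \<and> ((x + 1, 0) \<in> Q \<or> (x - 1, 0) \<in> Q)"
        using r(1) p(2) x(1) by auto
    qed (use Q q in auto)
    then have "Q \<subseteq> range line" unfolding line_def by blast
    then show ?thesis
      using int_interval_of_curve[OF homogeneous_line Q(1)] Q(2,3) that by metis
  qed
qed

lemma straight_comparable:
  assumes "polyomino P" "\<not> L_poly 2 \<sqsubseteq> P" "polyomino Q" "\<not> L_poly 2 \<sqsubseteq> Q"
  shows "P \<sqsubseteq> Q \<or> Q \<sqsubseteq> P"
proof -
  obtain I where I: "int_interval I" "P \<sqsubseteq> line ` I" "line ` I \<sqsubseteq> P"
    using straight_representation[OF assms(1,2)] .
  obtain J where J: "int_interval J" "Q \<sqsubseteq> line ` J" "line ` J \<sqsubseteq> Q"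
    using straight_representation[OF assms(3,4)] .
  show ?thesis using curve_comparable[OF homogeneous_line I(1) J(1)] I J ancestor_trans by blast
qed

lemma S_poly_eq_line: "S_poly n = line ` {0..<int n}"
  unfolding S_poly_def line_def by (force simp: image_iff dest: zero_le_imp_eq_int)

lemma straight_dichotomy:
  assumes "polyomino P" "\<not> L_poly 2 \<sqsubseteq> P" and n: "n \<ge> 1"
  shows "P \<sqsubseteq> S_poly n \<or> S_poly (Suc n) \<sqsubseteq> P"
proof -
  obtain I where I: "int_interval I" "P \<sqsubseteq> line ` I" "line ` I \<sqsubseteq> P"
    using straight_representation[OF assms(1,2)] .
  have shift: "line ` {a..<a + int m} \<sqsubseteq> S_poly m \<and> S_poly m \<sqsubseteq> line ` {a..<a + int m}" for a m
  proof
    show "line ` {a..<a + int m} \<sqsubseteq> S_poly m"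
      by (rule ancestorI[OF board_congruences_memI(1)[of "- a" 0]]) (auto simp: S_poly_eq_line line_def)
    show "S_poly m \<sqsubseteq> line ` {a..<a + int m}"
      by (rule ancestorI[OF board_congruences_memI(1)[of "a" 0]]) (auto simp: S_poly_eq_line line_def)
  qed
  have "(\<exists>a. {a..<a + int (Suc n)} \<subseteq> I) \<or> (\<exists>a. I \<subseteq> {a..<a + int n})"
    using int_interval_length[OF I(1), of "int n"] n
    by (auto simp: atLeastLessThanPlusOne_atLeastAtMost_int[symmetric] add_ac)
  then show ?thesis using shift I ancestor_trans ancestor_mono[OF image_mono] by meson
qed

section \<open>Staircase polyominoes\<close>

lemma S3_free:
  assumes "\<not> S_poly 3 \<sqsubseteq> Q"
  shows "\<not> ((x, y) \<in> Q \<and> (x + 1, y) \<in> Q \<and> (x + 2, y) \<in> Q)"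
    "\<not> ((x, y) \<in> Q \<and> (x, y + 1) \<in> Q \<and> (x, y + 2) \<in> Q)"
  using assms ancestorI[OF board_congruences_memI(1)[of x y], of "S_poly 3" Q]
    ancestorI[OF board_congruences_memI(5)[of x y], of "S_poly 3" Q] by (auto simp: small_polys)

lemma C2_free:
  assumes "\<not> C2 \<sqsubseteq> Q"
  shows "\<not> ((x, y) \<in> Q \<and> (x + 1, y) \<in> Q \<and> (x, y + 1) \<in> Q \<and> (x + 1, y + 1) \<in> Q)"
  using assms ancestorI[OF board_congruences_memI(1)[of x y], of C2 Q] by (auto simp: small_polys)

text \<open>After moving a copy of \<open>L_poly 2\<close> to the origin, the polyomino can only
  continue along \<open>stair\<close>: going straight on creates \<open>S_poly 3\<close>, and
  turning back creates \<open>C2\<close>.\<close>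

lemma stair_representation:
  assumes P: "polyomino P" and L2: "L_poly 2 \<sqsubseteq> P" and free: "\<not> S_poly 3 \<sqsubseteq> P" "\<not> C2 \<sqsubseteq> P"
  obtains I where "int_interval I" "P \<sqsubseteq> stair ` I" "stair ` I \<sqsubseteq> P"
proof -
  obtain f where f: "f \<in> board_congruences" "f ` L_poly 2 \<subseteq> P"
    using L2 by (auto simp: ancestor_iff)
  define Q where "Q = f -` P"
  have Q: "polyomino Q" "P \<sqsubseteq> Q" "Q \<sqsubseteq> P" "(0, 0) \<in> Q" "(1, 0) \<in> Q" "(0, 1) \<in> Q"
    unfolding Q_def using f P by (simp_all add: polyomino_vimage ancestor_vimage small_polys)
  have "\<not> S_poly 3 \<sqsubseteq> Q" "\<not> C2 \<sqsubseteq> Q" using free f(1) by (simp_all add: Q_def ancestor_vimage_iff)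
  note S3 = S3_free[OF this(1)] and C2 = C2_free[OF this(2)]
  \<comment> \<open>\<open>R i\<close> says that \<open>stair i\<close> is the last, the middle or
    the first of three consecutive indices, the other two of which are occupied.\<close>
  define R where "R i \<longleftrightarrow> stair (i - 2) \<in> Q \<and> stair (i - 1) \<in> Q \<or> stair (i - 1) \<in> Q \<and> stair (i + 1) \<in> Q
    \<or> stair (i + 1) \<in> Q \<and> stair (i + 2) \<in> Q" for i
  have "\<exists>i. q = stair i \<and> R i" if q: "q \<in> Q" for q
  proof (rule cell_connected_induct[where p = "stair 0" and P = Q])
    show "cell_connected Q" using Q(1) by (simp add: polyomino_def)
    show "stair 0 \<in> Q" using Q by (simp add: stair_def)
    show "\<exists>i. stair 0 = stair i \<and> R i"
      using Q by (intro exI[of _ 0]) (simp add: stair_def R_def)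
    fix p r
    assume p: "\<exists>i. p = stair i \<and> R i" "p \<in> Q" and r: "r \<in> Q" "adjacent p r"
    then obtain i where i: "p = stair i" "R i" by blast
    obtain k where k: "i = 2 * k \<or> i = 2 * k + 1" by (metis oddE evenE)
    obtain x y where xy: "r = (x, y)" by fastforce
    \<comment> \<open>Each of the two neighbours off the staircase would complete an
      \<open>S_poly 3\<close> or a \<open>C2\<close> with the cells given by
      \<open>R i\<close>.\<close>
    have "r = stair (i + 1) \<or> r = stair (i - 1)"
      using k
    proof
      assume "i = 2 * k"
      then have st: "stair (i - 2) = (1 - k, k - 1)" "stair (i - 1) = (1 - k, k)" "stair i = (- k, k)"
        "stair (i + 1) = (- k, k + 1)" "stair (i + 2) = (- k - 1, k + 1)"
        by (simp_all add: stair_def)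
      have "r = stair (i + 1) \<or> r = stair (i - 1) \<or> r = (- k - 1, k) \<or> r = (- k, k - 1)"
        using r(2) xy st unfolding i by (auto simp: adjacent_def)
      moreover have "(- k - 1, k) \<notin> Q"
        using i(2) p(2) st S3(1)[of "- k - 1" k] C2[of "- k - 1" k] unfolding R_def i
        by (auto simp: algebra_simps)
      moreover have "(- k, k - 1) \<notin> Q"
        using i(2) p(2) st S3(2)[of "- k" "k - 1"] C2[of "- k" "k - 1"] unfolding R_def i
        by (auto simp: algebra_simps)
      ultimately show ?thesis using r by blast
    next
      assume "i = 2 * k + 1"
      then have st: "stair (i - 2) = (1 - k, k)" "stair (i - 1) = (- k, k)" "stair i = (- k, k + 1)"
        "stair (i + 1) = (- k - 1, k + 1)" "stair (i + 2) = (- k - 1, k + 2)"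
        by (simp_all add: stair_def)
      have "r = stair (i + 1) \<or> r = stair (i - 1) \<or> r = (- k + 1, k + 1) \<or> r = (- k, k + 2)"
        using r(2) xy st unfolding i by (auto simp: adjacent_def)
      moreover have "(- k + 1, k + 1) \<notin> Q"
        using i(2) p(2) st S3(1)[of "- k - 1" "k + 1"] C2[of "- k" k] unfolding R_def i
        by (auto simp: algebra_simps)
      moreover have "(- k, k + 2) \<notin> Q"
        using i(2) p(2) st S3(2)[of "- k" "k"] C2[of "- k - 1" "k + 1"] unfolding R_def i
        by (auto simp: algebra_simps)
      ultimately show ?thesis using r by blast
    qed
    then show "\<exists>i. r = stair i \<and> R i"
    proof
      assume "r = stair (i + 1)"
      then show ?thesis using i p r unfolding R_def by (intro exI[of _ "i + 1"]) (auto simp: algebra_simps)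
    next
      assume "r = stair (i - 1)"
      then show ?thesis using i p r unfolding R_def by (intro exI[of _ "i - 1"]) (auto simp: algebra_simps)
    qed
  qed (use q in auto)
  then have "Q \<subseteq> range stair" by blast
  then show ?thesis
    using int_interval_of_curve[OF homogeneous_stair Q(1)] Q(2,3) that by metis
qed

lemma stair_comparable:
  assumes "polyomino P" "L_poly 2 \<sqsubseteq> P" "\<not> S_poly 3 \<sqsubseteq> P" "\<not> C2 \<sqsubseteq> P"
    and "polyomino Q" "L_poly 2 \<sqsubseteq> Q" "\<not> S_poly 3 \<sqsubseteq> Q" "\<not> C2 \<sqsubseteq> Q"
  shows "P \<sqsubseteq> Q \<or> Q \<sqsubseteq> P"
proof -
  obtain I where I: "int_interval I" "P \<sqsubseteq> stair ` I" "stair ` I \<sqsubseteq> P"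
    using stair_representation[OF assms(1-4)] .
  obtain J where J: "int_interval J" "Q \<sqsubseteq> stair ` J" "stair ` J \<sqsubseteq> Q"
    using stair_representation[OF assms(5-8)] .
  show ?thesis using curve_comparable[OF homogeneous_stair I(1) J(1)] I J ancestor_trans by blast
qed

section \<open>Teams of size four\<close>

text \<open>\<open>Q\<close> is not exhausted by its copy of \<open>P\<close>, so by connectedness
  it has a cell bordering that copy, which is pulled back to \<open>P\<close>.\<close>

lemma proper_extension:
  assumes Q: "polyomino Q" and "P \<sqsubseteq> Q" "\<not> Q \<sqsubseteq> P" "P \<noteq> {}"
  obtains c d where "c \<in> P" "d \<notin> P" "adjacent c d" "insert d P \<sqsubseteq> Q"
proof -
  obtain f where f: "f \<in> board_congruences" "f ` P \<subseteq> Q" using assms(2) by (auto simp: ancestor_iff)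
  have "\<not> Q \<subseteq> f ` P"
    using assms(3) ancestor_image[OF f(1)] ancestor_mono ancestor_trans by blast
  then obtain c' d' where cd: "c' \<in> f ` P" "d' \<in> Q" "d' \<notin> f ` P" "adjacent c' d'"
    using cell_connected_exit[of Q "f ` P"] Q f(2) \<open>P \<noteq> {}\<close> unfolding polyomino_def by blast
  obtain c where c: "c \<in> P" "c' = f c" using cd by blast
  obtain d where d: "d' = f d" using bij_board_congruence[OF f(1)] by (metis bij_pointE)
  have "f ` insert d P \<subseteq> Q" using cd d f(2) by simp
  then have "insert d P \<sqsubseteq> Q" by (rule ancestorI[OF f(1)])
  moreover have "d \<notin> P" using cd d by blast
  moreover have "adjacent c d" using cd c d adjacent_board_congruence[OF f(1)] by simp
  ultimately show thesis using that c by blast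
qed

lemma adjacent_cases:
  assumes "adjacent c d"
  shows "d \<in> {(fst c + 1, snd c), (fst c - 1, snd c), (fst c, snd c + 1), (fst c, snd c - 1)}"
proof -
  obtain x y u v where cd: "c = (x, y)" "d = (u, v)" by fastforce
  have "\<bar>x - u\<bar> + \<bar>y - v\<bar> = 1" using assms cd by (simp add: adjacent_def)
  then have "u = x + 1 \<and> v = y \<or> u = x - 1 \<and> v = y \<or> u = x \<and> v = y + 1 \<or> u = x \<and> v = y - 1"
    by linarith
  then show ?thesis using cd by auto
qed

text \<open>The seven cells bordering \<open>L_poly 2\<close> give these four polyominoes up to
  congruence.\<close>

lemma L2_proper_descendant:
  assumes "polyomino Q" "L_poly 2 \<sqsubseteq> Q" "\<not> Q \<sqsubseteq> L_poly 2"
  shows "L_poly 3 \<sqsubseteq> Q \<or> T2 \<sqsubseteq> Q \<or> C2 \<sqsubseteq> Q \<or> Z2 \<sqsubseteq> Q"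
proof -
  have "L_poly 2 \<noteq> {}" by (simp add: small_polys)
  then obtain c d where c: "c \<in> L_poly 2" and d: "d \<notin> L_poly 2" "adjacent c d" "insert d (L_poly 2) \<sqsubseteq> Q"
    using proper_extension[OF assms] by blast
  have "d \<in> {(2, 0), (0, 2), (1, 1), (-1, 0), (0, -1), (-1, 1), (1, -1)}"
    using c adjacent_cases[OF d(2)] d(1) unfolding L_poly_2 by (elim insertE emptyE) simp_all
  moreover have "L_poly 3 \<sqsubseteq> insert (2, 0) (L_poly 2)" "L_poly 3 \<sqsubseteq> insert (0, 2) (L_poly 2)"
    "T2 \<sqsubseteq> insert (-1, 0) (L_poly 2)" "T2 \<sqsubseteq> insert (0, -1) (L_poly 2)"
    "C2 \<sqsubseteq> insert (1, 1) (L_poly 2)"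
    "Z2 \<sqsubseteq> insert (-1, 1) (L_poly 2)" "Z2 \<sqsubseteq> insert (1, -1) (L_poly 2)"
    by (simp_all add: small_polys ancestor_iff_linear)
  ultimately have "L_poly 3 \<sqsubseteq> insert d (L_poly 2) \<or> T2 \<sqsubseteq> insert d (L_poly 2) \<or>
      C2 \<sqsubseteq> insert d (L_poly 2) \<or> Z2 \<sqsubseteq> insert d (L_poly 2)"
    by blast
  then show ?thesis using d(3) ancestor_trans by blast
qed

lemma C2_proper_descendant:
  assumes "polyomino Q" "C2 \<sqsubseteq> Q" "\<not> Q \<sqsubseteq> C2"
  shows "S_poly 3 \<sqsubseteq> Q"
proof -
  have "C2 \<noteq> {}" by (simp add: small_polys)
  then obtain c d where c: "c \<in> C2" and d: "d \<notin> C2" "adjacent c d" "insert d C2 \<sqsubseteq> Q"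
    using proper_extension[OF assms] by blast
  have "d \<in> {(2, 0), (0, 2), (2, 1), (1, 2), (-1, 0), (0, -1), (-1, 1), (1, -1)}"
    using c adjacent_cases[OF d(2)] d(1) unfolding C2_def by (elim insertE emptyE) simp_all
  moreover have "S_poly 3 \<sqsubseteq> insert (2, 0) C2" "S_poly 3 \<sqsubseteq> insert (0, 2) C2"
    "S_poly 3 \<sqsubseteq> insert (2, 1) C2" "S_poly 3 \<sqsubseteq> insert (1, 2) C2"
    "S_poly 3 \<sqsubseteq> insert (-1, 0) C2" "S_poly 3 \<sqsubseteq> insert (0, -1) C2"
    "S_poly 3 \<sqsubseteq> insert (-1, 1) C2" "S_poly 3 \<sqsubseteq> insert (1, -1) C2"
    by (simp_all add: small_polys ancestor_iff_linear)
  ultimately have "S_poly 3 \<sqsubseteq> insert d C2" by blast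
  then show ?thesis using d(3) ancestor_trans by blast
qed

lemma card_insert3_le: "card {a, b, c} \<le> 3"
  using card_length[of "[a, b, c]"] by simp

section \<open>The members of a hypothetical counterexample\<close>

lemma size_4_team_cases:
  assumes team: "team \<F>" and card: "card \<F> = 4"
  shows "\<exists>\<N>\<in>{{L_poly 2}, {S_poly 3, Z2}, {S_poly 3, C2},
    {S_poly 4, L_poly 3, C2, Z2}, {S_poly 4, T2, C2, Z2}}. \<N> \<preceq> \<F>"
proof (rule ccontr)
  assume "\<not> ?thesis"
  then have not1: "\<not> {L_poly 2} \<preceq> \<F>" and not2: "\<not> {S_poly 3, Z2} \<preceq> \<F>"
    and not3: "\<not> {S_poly 3, C2} \<preceq> \<F>" and not4: "\<not> {S_poly 4, L_poly 3, C2, Z2} \<preceq> \<F>"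
    and not5: "\<not> {S_poly 4, T2, C2, Z2} \<preceq> \<F>" by simp_all
  have poly: "polyomino P" if "P \<in> \<F>" for P using team that by (simp add: team_def)
  have eq: "P = Q" if "P \<in> \<F>" "Q \<in> \<F>" "P \<sqsubseteq> Q \<or> Q \<sqsubseteq> P" for P Q
    using team that unfolding team_def by metis
  \<comment> \<open>Four members cannot all be among three named ones; each use names members to
    which the whole team would otherwise collapse.\<close>
  have large: "\<exists>P\<in>\<F>. P \<notin> {A, B, C}" for A B C
  proof (rule ccontr)
    assume "\<not> ?thesis"
    then have "\<F> \<subseteq> {A, B, C}" by blast
    then have "card \<F> \<le> card {A, B, C}" by (intro card_mono) auto
    then show False using card card_insert3_le[of A B C] by simp
  qed
  obtain Q1 where Q1: "Q1 \<in> \<F>" "\<not> L_poly 2 \<sqsubseteq> Q1" using not1 by (auto simp: simpler_def)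
  obtain Q2 where Q2: "Q2 \<in> \<F>" "\<not> S_poly 3 \<sqsubseteq> Q2" "\<not> Z2 \<sqsubseteq> Q2" using not2 by (auto simp: simpler_def)
  obtain Q3 where Q3: "Q3 \<in> \<F>" "\<not> S_poly 3 \<sqsubseteq> Q3" "\<not> C2 \<sqsubseteq> Q3" using not3 by (auto simp: simpler_def)
  have straight: "P = Q1" if "P \<in> \<F>" "\<not> L_poly 2 \<sqsubseteq> P" for P
    using straight_comparable poly that Q1 eq by blast
  \<comment> \<open>Any other member would be straight, hence \<open>Q1\<close>, or lie above
    \<open>L_poly 2\<close> and so above \<open>P\<close>, leaving at most two members.\<close>
  have not_L2: "\<not> P \<sqsubseteq> L_poly 2" if "P \<in> \<F>" for P
  proof
    assume "P \<sqsubseteq> L_poly 2"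
    then have "Q = P \<or> Q = Q1" if "Q \<in> \<F>" for Q
      using that \<open>P \<in> \<F>\<close> straight eq ancestor_trans by blast
    then show False using large[of P Q1 Q1] by blast
  qed
  have bent: "L_poly 3 \<sqsubseteq> P \<or> T2 \<sqsubseteq> P \<or> C2 \<sqsubseteq> P \<or> Z2 \<sqsubseteq> P" if "P \<in> \<F>" "L_poly 2 \<sqsubseteq> P" for P
    using L2_proper_descendant poly not_L2 that by blast
  \<comment> \<open>A straight \<open>P\<close> without \<open>S_poly 3\<close> would lie below
    \<open>S_poly 2\<close> and so below \<open>L_poly 2\<close>. Of the extensions of
    \<open>L_poly 2\<close>, only \<open>C2\<close> and \<open>Z2\<close> avoid
    \<open>S_poly 3\<close>.\<close>
  have S3_free: "L_poly 2 \<sqsubseteq> P \<and> (C2 \<sqsubseteq> P \<or> Z2 \<sqsubseteq> P)" if P: "P \<in> \<F>" "\<not> S_poly 3 \<sqsubseteq> P" for P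
  proof -
    have "S_poly 2 \<sqsubseteq> L_poly 2" by (rule ancestor_mono) (auto simp: L_poly_def)
    then have "\<not> P \<sqsubseteq> S_poly 2" using not_L2[OF P(1)] ancestor_trans by blast
    then have "L_poly 2 \<sqsubseteq> P"
      using straight_dichotomy[OF poly[OF P(1)], of 2] P(2) by (auto simp: numeral_3_eq_3 numeral_2_eq_2)
    then show ?thesis using bent[OF P(1)] P(2) S3_ancestor ancestor_trans by blast
  qed
  have "C2 \<sqsubseteq> Q2" using S3_free Q2 by blast
  then have "Q2 \<sqsubseteq> C2" using C2_proper_descendant poly Q2 by blast
  then have square: "P = Q2" if "P \<in> \<F>" "C2 \<sqsubseteq> P" for P
    using that Q2 eq ancestor_trans by blast
  have staircase: "P = Q3" if "P \<in> \<F>" "\<not> S_poly 3 \<sqsubseteq> P" "\<not> C2 \<sqsubseteq> P" for P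
    using stair_comparable[of P Q3] S3_free poly that Q3 eq by blast
  have Z2_Q3: "Z2 \<sqsubseteq> Q3" using S3_free Q3 by blast
  \<comment> \<open>If \<open>Q1\<close> were below \<open>S_poly 3\<close>, every other member
    would avoid \<open>S_poly 3\<close> and thus be the square \<open>Q2\<close> or the staircase
    \<open>Q3\<close>.\<close>
  have "S_poly 4 \<sqsubseteq> Q1"
  proof (rule ccontr)
    assume "\<not> S_poly 4 \<sqsubseteq> Q1"
    then have "Q1 \<sqsubseteq> S_poly 3"
      using straight_dichotomy[OF poly[OF Q1(1)] Q1(2), of 3] by simp
    then have "P = Q1" if "P \<in> \<F>" "S_poly 3 \<sqsubseteq> P" for P
      using that Q1 eq ancestor_trans by blast
    then show False using large[of Q1 Q2 Q3] square staircase by blast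
  qed
  obtain D where D: "D \<in> \<F>" "D \<notin> {Q1, Q2, Q3}" using large[of Q1 Q2 Q3] by blast
  have "Q1 \<noteq> Q2" "Q1 \<noteq> Q3" "Q2 \<noteq> Q3" using Q1 Q2 Q3 S3_free \<open>C2 \<sqsubseteq> Q2\<close> by blast+
  moreover have "D \<noteq> Q1" "D \<noteq> Q2" "D \<noteq> Q3" using D(2) by blast+
  ultimately have "card {Q1, Q2, Q3, D} = card \<F>" unfolding card by (simp add: not_sym)
  moreover have "finite \<F>" using card by (metis card.infinite zero_neq_numeral)
  ultimately have "\<F> = {Q1, Q2, Q3, D}"
    using card_subset_eq[of \<F> "{Q1, Q2, Q3, D}"] Q1(1) Q2(1) Q3(1) D(1) by blast
  \<comment> \<open>As \<open>D\<close> differs from the only straight member, it is bent. If it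
    contains \<open>T2\<close>, the fifth set is simpler than the team; in the other three cases the
    fourth set is.\<close>
  moreover have "L_poly 3 \<sqsubseteq> D \<or> T2 \<sqsubseteq> D \<or> C2 \<sqsubseteq> D \<or> Z2 \<sqsubseteq> D"
    using bent straight D by blast
  ultimately show False
    using not4 not5 \<open>S_poly 4 \<sqsubseteq> Q1\<close> \<open>C2 \<sqsubseteq> Q2\<close> Z2_Q3 unfolding simpler_def by blast
qed

theorem proposition6p6:
  "\<not> (\<exists>\<F>. team \<F> \<and> card \<F> = 4 \<and> winner \<F>) \<and>
   characterizing_losers 4
     {{L_poly 2}, {S_poly 3, Z2}, {S_poly 3, C2},
      {S_poly 4, L_poly 3, C2, Z2}, {S_poly 4, T2, C2, Z2}}"
    (is "_ \<and> characterizing_losers 4 ?\<C>")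
proof -
  have poly: "polyomino P \<and> finite P" if "\<N> \<in> ?\<C>" "P \<in> \<N>" for \<N> P
  proof -
    have "P \<in> {L_poly 2, L_poly 3, S_poly 3, S_poly 4, T2, C2, Z2}" using that by auto
    then show ?thesis using polyomino_small by (auto simp: small_polys)
  qed
  have no_win: "\<not> winning_strategy \<N> \<sigma>" if "\<N> \<in> ?\<C>" for \<N> \<sigma>
    using that no_win_L2 no_win_S3_Z2 no_win_S3_C2 no_win_S4_L3_C2_Z2 no_win_S4_T2_C2_Z2 by auto
  have loses: "loser \<F>" if "\<N> \<in> ?\<C>" "\<N> \<preceq> \<F>" for \<N> \<F>
    by (rule loser_if_no_winning_strategy[of \<N>]) (fact poly[OF that(1)] no_win[OF that(1)] that(2))+
  \<comment> \<open>With reflexivity, \<open>loses\<close> also applies to the five sets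
    themselves.\<close>
  have refl: "\<N> \<preceq> \<N>" for \<N> unfolding simpler_def using ancestor_mono by blast
  have team: "team \<N>" if "\<N> \<in> ?\<C>" for \<N>
    using that polyomino_small not_ancestor_small unfolding team_def by auto
  show ?thesis
    unfolding characterizing_losers_def
  proof (intro conjI ballI allI impI notI)
    assume "\<exists>\<F>. team \<F> \<and> card \<F> = 4 \<and> winner \<F>"
    then obtain \<F> where "team \<F>" "card \<F> = 4" and win: "winner \<F>" by (elim exE conjE)
    from size_4_team_cases[OF this(1,2)] obtain \<N> where \<N>: "\<N> \<in> ?\<C>" "\<N> \<preceq> \<F>" ..
    show False using loses[OF \<N>] win by (rule notE)
  next
    fix \<F> assume "team \<F> \<and> card \<F> = 4"
    then have "team \<F>" "card \<F> = 4" by simp_all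
    then show "\<exists>\<N>\<in>?\<C>. \<N> \<preceq> \<F>" by (rule size_4_team_cases)
  next
    fix \<N> assume "\<N> \<in> ?\<C>"
    then show "team \<N>" by (rule team)
  next
    fix \<N> assume \<N>: "\<N> \<in> ?\<C>" and win: "winner \<N>"
    show False using loses[OF \<N> refl] win by (rule notE)
  qed
qed

end
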